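(* Let $D$ be an integral domain which is not a field, with quotient field $K$, let $\overline{K}$ be an algebraic closure of $K$, and let $\overline{D}$ be the integral closure of $D$ in $\overline{K}$. Let $p(X)$ be a monic non-constant polynomial in $D[X]$, and let $\Omega_p$ be the (multi-)set of roots of $p(X)$ in $\overline{K}$. Then the integral closure of the ring $D(p)=D[X]+p(X)K[X]$ (in its quotient field $K(X)$) is the ring $\mathrm{Int}_K(\Omega_p,\overline{D})$.
   Context: For a monic non-constant $p\in D[X]$, $D(p)=D[X]+p(X)K[X]=\{r(X)+p(X)q(X) : r\in D[X],\ q\in K[X]\}$, a subring of $K[X]$. For a subset $\Omega\subseteq\overline{K}$, $\mathrm{Int}_K(\Omega,\overline{D})=\{f\in K[X] : f(\alpha)\in\overline{D}\text{ for all }\alpha\in\Omega\}$; for a multi-set $\Omega$ this means the ring attached to its underlying set of distinct elements. *)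

theory Defs
  imports
    "HOL-Computational_Algebra.Polynomial"
    "HOL-Computational_Algebra.Polynomial_Factorial"
begin

definition is_subring :: "'a :: comm_ring_1 set \<Rightarrow> bool" where
  "is_subring A \<longleftrightarrow>
     1 \<in> A \<and> (\<forall>x\<in>A. \<forall>y\<in>A. x - y \<in> A) \<and> (\<forall>x\<in>A. \<forall>y\<in>A. x * y \<in> A)"

text \<open>\<open>A\<close> is a subring (hence an integral domain) of the ambient field, whose quotient field
  is the whole ambient field. Every integral domain arises in this way, up to isomorphism, inside
  its quotient field.\<close>

definition domain_with_quotient_field_UNIV :: "'a :: field set \<Rightarrow> bool" where
  "domain_with_quotient_field_UNIV A \<longleftrightarrow>
     is_subring A \<and> (\<forall>x. \<exists>a\<in>A. \<exists>b\<in>A. b \<noteq> 0 \<and> x = a / b)"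

definition is_subfield :: "'a :: field set \<Rightarrow> bool" where
  "is_subfield A \<longleftrightarrow> is_subring A \<and> (\<forall>x\<in>A. x \<noteq> 0 \<longrightarrow> inverse x \<in> A)"

definition is_field_embedding :: "('a :: field \<Rightarrow> 'b :: field) \<Rightarrow> bool" where
  "is_field_embedding \<iota> \<longleftrightarrow>
     \<iota> 1 = 1 \<and> (\<forall>x y. \<iota> (x + y) = \<iota> x + \<iota> y) \<and> (\<forall>x y. \<iota> (x * y) = \<iota> x * \<iota> y)"

text \<open>The target type is algebraically closed by its type class.\<close>

definition is_algebraic_closure :: "('k :: field \<Rightarrow> 'l :: alg_closed_field) \<Rightarrow> bool" where
  "is_algebraic_closure \<iota> \<longleftrightarrow>
     is_field_embedding \<iota> \<and> (\<forall>y. \<exists>q. q \<noteq> 0 \<and> poly (map_poly \<iota> q) y = 0)"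

definition polys_over :: "'a :: zero set \<Rightarrow> 'a poly set" where
  "polys_over A = {q. \<forall>i. coeff q i \<in> A}"

text \<open>The integral closure of the subring \<open>A\<close> in the whole ambient ring.\<close>

definition integral_closure :: "'a :: comm_ring_1 set \<Rightarrow> 'a set" where
  "integral_closure A = {x. \<exists>q\<in>polys_over A. lead_coeff q = 1 \<and> poly q x = 0}"

definition D_p_ring :: "'k :: field set \<Rightarrow> 'k poly \<Rightarrow> 'k poly set" where
  "D_p_ring D p = {r + p * q | r q. r \<in> polys_over D}"

definition Int_K ::
  "('k :: field \<Rightarrow> 'l :: field) \<Rightarrow> 'l set \<Rightarrow> 'l set \<Rightarrow> 'k poly set" where
  "Int_K \<iota> \<Omega> R = {f. \<forall>\<alpha>\<in>\<Omega>. poly (map_poly \<iota> f) \<alpha> \<in> R}"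

definition roots_in :: "('k :: field \<Rightarrow> 'l :: field) \<Rightarrow> 'k poly \<Rightarrow> 'l multiset" where
  "roots_in \<iota> p = proots (map_poly \<iota> p)"

end

theory Submission
  imports Defs "Jordan_Normal_Form.Char_Poly"
begin

text \<open>
  Both inclusions rest on comparing a polynomial \<open>f\<close> over \<open>K\<close> with its values at the roots of \<open>p\<close>.

  If a rational function is integral over \<open>D(p)\<close>, it is integral over \<open>K[X]\<close>, hence is a
  polynomial \<open>f\<close> (\<open>integral_closure_range_to_fract_poly\<close>). Evaluation at a root \<open>\<alpha>\<close> of \<open>p\<close> kills
  the summand \<open>p K[X]\<close> and so maps \<open>D(p)\<close> into \<open>D[\<alpha>]\<close>. Therefore \<open>f(\<alpha>)\<close> is integral over
  \<open>D[\<alpha>]\<close>; and \<open>\<alpha>\<close> is integral over \<open>D\<close> because \<open>p\<close> is monic. Transitivity of integrality in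
  this one-generator case (\<open>integral_closure_tower\<close>) shows that \<open>f(\<alpha>)\<close> is integral over \<open>D\<close>.

  Conversely, let every \<open>f(\<alpha>)\<close> be integral over \<open>D\<close>. The product \<open>G\<close> of monic polynomials over
  \<open>D\<close> annihilating these values makes \<open>G(f)\<close> vanish at each root of \<open>p\<close>. Since \<open>p\<close> splits into
  \<open>deg p\<close> linear factors, each of which divides \<open>G(f)\<close>, it divides the power \<open>G(f)^(deg p)\<close>
  (\<open>splitting_poly_dvd_power\<close>), first over the algebraic closure and then over \<open>K\<close>. So a
  monic polynomial over \<open>D\<close> takes \<open>f\<close> into \<open>p K[X]\<close>, which lies in \<open>D(p)\<close>, and correcting its
  constant term by that value gives an equation of integral dependence over \<open>D(p)\<close>
  (\<open>integral_over_D_p_ring_if_dvd_pcompose\<close>).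

  Finally \<open>K(X)\<close> is the quotient field of \<open>D(p)\<close>, since a fraction \<open>a / b\<close> of polynomials equals
  \<open>(p a) / (p b)\<close>.
\<close>

section \<open>Subrings and their polynomial rings\<close>

lemma is_subring_closed:
  assumes "is_subring A"
  shows "1 \<in> A" "0 \<in> A" "x \<in> A \<Longrightarrow> y \<in> A \<Longrightarrow> x - y \<in> A" "x \<in> A \<Longrightarrow> - x \<in> A"
    "x \<in> A \<Longrightarrow> y \<in> A \<Longrightarrow> x + y \<in> A" "x \<in> A \<Longrightarrow> y \<in> A \<Longrightarrow> x * y \<in> A"
proof -
  show 1: "1 \<in> A" using assms by (simp add: is_subring_def)
  show d: "x - y \<in> A" if "x \<in> A" "y \<in> A" for x y
    using assms that by (auto simp: is_subring_def)
  show 0: "0 \<in> A" using d[OF 1 1] by simp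
  show m: "- x \<in> A" if "x \<in> A" for x using d[OF 0 that] by simp
  show "x + y \<in> A" if "x \<in> A" "y \<in> A" using d[OF that(1) m[OF that(2)]] by simp
  show "x * y \<in> A" if "x \<in> A" "y \<in> A" using assms that by (auto simp: is_subring_def)
qed

lemma is_subring_sum:
  assumes "is_subring A" "\<And>i. i \<in> I \<Longrightarrow> f i \<in> A"
  shows "sum f I \<in> A"
  using assms(2) by (induction I rule: infinite_finite_induct) (auto simp: is_subring_closed[OF assms(1)])

lemma is_subring_prod:
  assumes "is_subring A" "\<And>i. i \<in> I \<Longrightarrow> f i \<in> A"
  shows "prod f I \<in> A"
  using assms(2) by (induction I rule: infinite_finite_induct) (auto simp: is_subring_closed[OF assms(1)])

lemma is_subring_power: "is_subring A \<Longrightarrow> x \<in> A \<Longrightarrow> x ^ n \<in> A"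
  by (induction n) (auto simp: is_subring_closed)

lemma is_subring_polys_over:
  assumes "is_subring A"
  shows "is_subring (polys_over A)"
  unfolding is_subring_def[of "polys_over A"]
  using is_subring_closed[OF assms]
  by (auto simp: polys_over_def coeff_mult intro!: is_subring_sum[OF assms])

lemma polys_over_pCons_iff: "pCons a q \<in> polys_over A \<longleftrightarrow> a \<in> A \<and> q \<in> polys_over A"
  by (auto simp: polys_over_def coeff_pCons split: nat.splits)

lemma integral_closure_mono: "A \<subseteq> B \<Longrightarrow> integral_closure A \<subseteq> integral_closure B"
  by (fastforce simp: integral_closure_def polys_over_def)

section \<open>Transitivity of integrality\<close>

lemma char_poly_polys_over:
  assumes A: "is_subring A" and M: "M \<in> carrier_mat n n"
    and "\<And>i j. i < n \<Longrightarrow> j < n \<Longrightarrow> M $$ (i, j) \<in> A"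
  shows "char_poly M \<in> polys_over A"
proof -
  note P = is_subring_polys_over[OF A]
  have entry: "char_poly_matrix M $$ (i, j) \<in> polys_over A" if "i < n" "j < n" for i j
    using that assms
    by (auto simp: char_poly_matrix_def polys_over_pCons_iff is_subring_closed
        is_subring_closed(1,2)[OF P])
  have sgn: "signof \<pi> \<in> polys_over A" for \<pi> :: "nat \<Rightarrow> nat"
    by (cases \<pi> rule: sign_cases) (simp_all add: is_subring_closed[OF P])
  show ?thesis
    unfolding char_poly_def det_def'[OF char_poly_matrix_closed[OF M]]
    by (intro is_subring_sum[OF P] is_subring_closed(6)[OF P] is_subring_prod[OF P] sgn entry)
      (auto simp: permutes_in_image)
qed

text \<open>
  The determinant trick: multiplication by \<open>x\<close> is described on the family \<open>v\<close> by a matrix with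
  entries in \<open>A\<close>. The vector of the \<open>v i\<close> is an eigenvector of this matrix for the eigenvalue \<open>x\<close>,
  so \<open>x\<close> is a root of its characteristic polynomial, which is monic over \<open>A\<close>.
\<close>

lemma integral_if_multiplies_finite_family_into_span:
  fixes x :: "'a :: field" and v :: "'i \<Rightarrow> 'a"
  assumes A: "is_subring A" and I: "finite I" and nz: "\<exists>i\<in>I. v i \<noteq> 0"
    and stable: "\<And>i. i \<in> I \<Longrightarrow> \<exists>c. (\<forall>j\<in>I. c j \<in> A) \<and> x * v i = (\<Sum>j\<in>I. c j * v j)"
  shows "x \<in> integral_closure A"
proof -
  obtain c where c: "\<And>i j. i \<in> I \<Longrightarrow> j \<in> I \<Longrightarrow> c i j \<in> A"
      "\<And>i. i \<in> I \<Longrightarrow> x * v i = (\<Sum>j\<in>I. c i j * v j)"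
    using stable by metis
  define n where "n = card I"
  obtain e where e: "bij_betw e {0..<n} I"
    using ex_bij_betw_nat_finite[OF I] by (auto simp: n_def)
  hence eI: "e i \<in> I" if "i < n" for i using that by (auto simp: bij_betw_def)
  define M where "M = mat n n (\<lambda>(i, j). c (e i) (e j))"
  define w where "w = vec n (\<lambda>i. v (e i))"
  have M: "M \<in> carrier_mat n n" by (simp add: M_def)
  have "w \<noteq> 0\<^sub>v n"
  proof
    assume "w = 0\<^sub>v n"
    moreover from nz obtain i where "i < n" "v (e i) \<noteq> 0"
      using e by (fastforce simp: bij_betw_def)
    ultimately show False by (metis index_vec index_zero_vec(1) w_def)
  qed
  moreover have "M *\<^sub>v w = x \<cdot>\<^sub>v w"
  proof (rule eq_vecI)
    fix i assume "i < dim_vec (x \<cdot>\<^sub>v w)"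
    hence i: "i < n" by (simp add: w_def)
    have "(M *\<^sub>v w) $ i = (\<Sum>j = 0..<n. c (e i) (e j) * v (e j))"
      using i by (simp add: M_def w_def scalar_prod_def)
    also have "\<dots> = x * v (e i)"
      using c(2)[OF eI[OF i]] sum.reindex_bij_betw[OF e, of "\<lambda>j. c (e i) j * v j"] by simp
    finally show "(M *\<^sub>v w) $ i = (x \<cdot>\<^sub>v w) $ i" using i by (simp add: w_def)
  qed (simp add: M_def w_def)
  ultimately have "eigenvalue M x"
    using M by (auto simp: eigenvalue_def eigenvector_def intro!: exI[of _ w]) (simp add: w_def)
  hence "poly (char_poly M) x = 0" using eigenvalue_root_char_poly[OF M] by simp
  moreover have "char_poly M \<in> polys_over A"
    using c(1) eI by (intro char_poly_polys_over[OF A M]) (simp add: M_def)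
  moreover have "lead_coeff (char_poly M) = 1" using degree_monic_char_poly[OF M] by simp
  ultimately show ?thesis by (auto simp: integral_closure_def)
qed

text \<open>
  Division with remainder by a monic polynomial stays over \<open>A\<close>: it shows that \<open>A[\<alpha>]\<close> is spanned
  over \<open>A\<close> by the powers of \<open>\<alpha>\<close> below the degree of \<open>m\<close>.
\<close>

lemma poly_value_reduce_mod_monic:
  assumes A: "is_subring A" and m: "m \<in> polys_over A" "lead_coeff m = 1" "poly m \<alpha> = 0"
    and r: "r \<in> polys_over A"
  shows "\<exists>c. (\<forall>i. c i \<in> A) \<and> poly r \<alpha> = (\<Sum>i<degree m. c i * \<alpha> ^ i)"
proof -
  note P = is_subring_polys_over[OF A]
  have "degree m > 0"
    using m by (metis degree_eq_zeroE gr0I lead_coeff_pCons(2) poly_const_conv zero_neq_one)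
  have "\<exists>s\<in>polys_over A. degree s < degree m \<and> poly s \<alpha> = poly r \<alpha>"
    using r
  proof (induction r)
    case 0
    show ?case using is_subring_closed(2)[OF P] \<open>degree m > 0\<close> by (intro bexI[of _ 0]) auto
  next
    case (pCons a r)
    then obtain s where s: "s \<in> polys_over A" "degree s < degree m" "poly s \<alpha> = poly r \<alpha>"
      by (auto simp: polys_over_pCons_iff)
    \<comment> \<open>Multiplying by the variable raises the degree to at most that of \<open>m\<close>, so subtracting one
      multiple of \<open>m\<close> restores the bound.\<close>
    define d where "d = coeff (pCons a s) (degree m)"
    define t where "t = pCons a s - Polynomial.smult d m"
    have a: "pCons a s \<in> polys_over A" using pCons.prems s by (simp add: polys_over_pCons_iff)
    have "d \<in> A" using a by (auto simp: d_def polys_over_def)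
    hence "t \<in> polys_over A"
      using m a by (auto simp: t_def polys_over_def is_subring_closed[OF A])
    moreover have "degree t < degree m"
    proof (rule degree_lessI)
      show "\<forall>k\<ge>degree m. coeff t k = 0"
      proof (intro allI impI)
        fix k assume "k \<ge> degree m"
        thus "coeff t k = 0"
        proof (cases "k = degree m")
          case True
          thus ?thesis using m by (simp add: t_def d_def)
        next
          case False
          with \<open>k \<ge> degree m\<close> have "degree m < k" by simp
          moreover have "degree (pCons a s) < k" using \<open>degree m < k\<close> s(2)
            by (metis degree_pCons_le less_Suc_eq_le less_le_trans not_less order_le_less_trans)
          ultimately show ?thesis by (simp add: t_def coeff_eq_0)
        qed
      qed
    qed (use \<open>degree m > 0\<close> in auto)
    moreover have "poly t \<alpha> = poly (pCons a r) \<alpha>" using m s by (simp add: t_def)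
    ultimately show ?case by blast
  qed
  then obtain s where s: "s \<in> polys_over A" "degree s < degree m" "poly s \<alpha> = poly r \<alpha>" by blast
  have "poly s \<alpha> = (\<Sum>i<degree m. coeff s i * \<alpha> ^ i)"
    unfolding poly_altdef using s(2)
    by (intro sum.mono_neutral_left) (auto simp: coeff_eq_0)
  with s show ?thesis by (intro exI[of _ "coeff s"]) (auto simp: polys_over_def)
qed

text \<open>
  If \<open>\<alpha>\<close> and \<open>x\<close> satisfy monic equations of degrees \<open>k\<close> and \<open>n\<close>, over \<open>A\<close> and over \<open>A[\<alpha>]\<close>
  respectively, then the \<open>A\<close>-span of the products \<open>\<alpha>^i * x^j\<close> with \<open>i < k\<close> and \<open>j < n\<close> is stable
  under multiplication by \<open>x\<close>, and the determinant trick applies.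
\<close>

lemma integral_closure_tower:
  fixes x \<alpha> :: "'a :: field"
  assumes A: "is_subring A" and \<alpha>: "\<alpha> \<in> integral_closure A"
    and x: "x \<in> integral_closure ((\<lambda>r. poly r \<alpha>) ` polys_over A)"
  shows "x \<in> integral_closure A"
proof -
  note P = is_subring_polys_over[OF A]
  obtain m where m: "m \<in> polys_over A" "lead_coeff m = 1" "poly m \<alpha> = 0"
    using \<alpha> by (auto simp: integral_closure_def)
  obtain q where q: "\<And>j. coeff q j \<in> (\<lambda>r. poly r \<alpha>) ` polys_over A" "lead_coeff q = 1" "poly q x = 0"
    using x by (auto simp: integral_closure_def polys_over_def)
  have deg0: "degree h > 0" if "lead_coeff h = 1" "poly h y = 0" for h :: "'a poly" and y
    using that by (metis degree_eq_zeroE gr0I lead_coeff_pCons(2) poly_const_conv zero_neq_one)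
  define I where "I = {..<degree m} \<times> {..<degree q}"
  define v where "v = (\<lambda>(i, j). \<alpha> ^ i * x ^ j)"
  define S where "S = {\<Sum>k\<in>I. c k * v k | c. \<forall>k\<in>I. c k \<in> A}"
  have I: "finite I" by (simp add: I_def)
  have S_add: "y + z \<in> S" if "y \<in> S" "z \<in> S" for y z
  proof -
    from that obtain c d where
      "\<forall>k\<in>I. c k \<in> A" "y = (\<Sum>k\<in>I. c k * v k)" "\<forall>k\<in>I. d k \<in> A" "z = (\<Sum>k\<in>I. d k * v k)"
      by (auto simp: S_def)
    thus ?thesis unfolding S_def
      by (intro CollectI exI[of _ "\<lambda>k. c k + d k"])
        (auto simp: sum.distrib ring_distribs is_subring_closed[OF A])
  qed
  have S_mult: "a * y \<in> S" if "a \<in> A" "y \<in> S" for a y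
  proof -
    from that obtain c where "\<forall>k\<in>I. c k \<in> A" "y = (\<Sum>k\<in>I. c k * v k)"
      by (auto simp: S_def)
    thus ?thesis unfolding S_def using that
      by (intro CollectI exI[of _ "\<lambda>k. a * c k"])
        (auto simp: sum_distrib_left mult_ac is_subring_closed[OF A])
  qed
  have S_0: "0 \<in> S" unfolding S_def
    by (intro CollectI exI[of _ "\<lambda>k. 0"]) (auto simp: is_subring_closed[OF A])
  have S_sum: "sum f J \<in> S" if "\<And>j. j \<in> J \<Longrightarrow> f j \<in> S" for f and J :: "nat set"
    using that by (induction J rule: infinite_finite_induct) (auto simp: S_0 S_add)
  have S_v: "v k \<in> S" if "k \<in> I" for k unfolding S_def
    by (intro CollectI exI[of _ "\<lambda>l. if l = k then 1 else 0"])
      (use I that in \<open>auto simp: is_subring_closed[OF A] if_distrib[of "\<lambda>t. t * _"] cong: if_cong\<close>)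
  have stable: "x * v k \<in> S" if k: "k \<in> I" for k
  proof -
    obtain i j where ij: "k = (i, j)" "i < degree m" "j < degree q" using k by (auto simp: I_def)
    show ?thesis
    proof (cases "Suc j < degree q")
      case True
      hence "v (i, Suc j) \<in> S" using ij by (intro S_v) (auto simp: I_def)
      thus ?thesis using ij by (simp add: v_def mult_ac)
    next
      case False
      \<comment> \<open>Here \<open>x * x ^ j\<close> is replaced by lower powers of \<open>x\<close> through \<open>q\<close>; afterwards the
        coefficients, which lie in \<open>A[\<alpha>]\<close>, are reduced modulo \<open>m\<close>.\<close>
      hence j: "degree q = Suc j" using ij by simp
      have "(\<Sum>l<degree q. coeff q l * x ^ l) + x ^ degree q = 0"
        using q(2,3) by (simp add: poly_altdef lessThan_Suc_atMost[symmetric])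
      hence "x ^ degree q = - (\<Sum>l<degree q. coeff q l * x ^ l)"
        by (simp add: eq_neg_iff_add_eq_0 add.commute)
      moreover have "x * v k = \<alpha> ^ i * x ^ degree q" using ij j by (simp add: v_def)
      ultimately have "x * v k = - 1 * (\<Sum>l<degree q. (\<alpha> ^ i * coeff q l) * x ^ l)"
        by (simp only:) (simp add: sum_distrib_left sum_negf mult_ac del: sum.lessThan_Suc)
      also have "\<dots> \<in> S"
      proof (rule S_mult[OF _ S_sum])
        show "- 1 \<in> A" by (simp add: is_subring_closed[OF A])
        fix l assume l: "l \<in> {..<degree q}"
        obtain r where r: "r \<in> polys_over A" "coeff q l = poly r \<alpha>" using q(1) by blast
        have "[:0, 1:] \<in> polys_over A"
          by (simp add: polys_over_pCons_iff is_subring_closed[OF A] is_subring_closed(2)[OF P])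
        hence "[:0, 1:] ^ i * r \<in> polys_over A"
          by (intro is_subring_closed(6)[OF P] is_subring_power[OF P] r)
        from poly_value_reduce_mod_monic[OF A m this] obtain c where c: "\<And>i. c i \<in> A"
          "poly ([:0, 1:] ^ i * r) \<alpha> = (\<Sum>i<degree m. c i * \<alpha> ^ i)" by blast
        hence "\<alpha> ^ i * coeff q l * x ^ l = (\<Sum>i<degree m. c i * \<alpha> ^ i) * x ^ l"
          using r by simp
        also have "\<dots> = (\<Sum>i<degree m. c i * v (i, l))"
          by (simp add: v_def sum_distrib_right mult.assoc)
        also have "\<dots> \<in> S"
          using c(1) l by (intro S_sum S_mult S_v) (auto simp: I_def)
        finally show "\<alpha> ^ i * coeff q l * x ^ l \<in> S" .
      qed
      finally show ?thesis .
    qed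
  qed
  show ?thesis
  proof (rule integral_if_multiplies_finite_family_into_span[OF A I])
    have "(0, 0) \<in> I" using deg0 m q by (auto simp: I_def)
    thus "\<exists>k\<in>I. v k \<noteq> 0" by (intro bexI[of _ "(0, 0)"]) (auto simp: v_def)
    show "\<exists>c. (\<forall>l\<in>I. c l \<in> A) \<and> x * v k = (\<Sum>l\<in>I. c l * v l)" if "k \<in> I" for k
      using stable[OF that] by (auto simp: S_def)
  qed
qed

section \<open>Integral closures and ring homomorphisms\<close>

lemma (in comm_ring_hom) hom_integral_closure:
  assumes "x \<in> integral_closure A"
  shows "hom x \<in> integral_closure (hom ` A)"
proof -
  obtain q where q: "q \<in> polys_over A" "lead_coeff q = 1" "poly q x = 0"
    using assms by (auto simp: integral_closure_def)
  have "degree (map_poly hom q) = degree q"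
    using q(2) by (intro degree_map_poly) auto
  with q have "lead_coeff (map_poly hom q) = 1" by simp
  moreover have "map_poly hom q \<in> polys_over (hom ` A)"
    using q by (auto simp: polys_over_def)
  moreover have "poly (map_poly hom q) (hom x) = 0" using q by simp
  ultimately show ?thesis unfolding integral_closure_def by blast
qed

text \<open>
  Lifting the coefficients by any choice of preimages could yield infinitely many nonzero ones;
  injectivity makes the chosen preimage of zero equal to zero.
\<close>

lemma (in inj_comm_ring_hom) polys_over_image:
  assumes "q \<in> polys_over (hom ` A)"
  shows "\<exists>q'\<in>polys_over A. q = map_poly hom q'"
proof
  have inv: "inv_into A hom 0 = 0" if "0 \<in> hom ` A"
    using inv_into_into[OF that] f_inv_into_f[OF that] by simp
  have c: "coeff q i \<in> hom ` A" for i using assms by (auto simp: polys_over_def)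
  have "0 \<in> hom ` A" using c[of "Suc (degree q)"] by (simp add: coeff_eq_0)
  note inv = inv[OF this]
  show "map_poly (inv_into A hom) q \<in> polys_over A"
    using inv_into_into[OF c] by (auto simp: polys_over_def coeff_map_poly[of "inv_into A hom", OF inv])
  show "q = map_poly hom (map_poly (inv_into A hom) q)"
    using f_inv_into_f[OF c] by (intro poly_eqI) (simp add: coeff_map_poly[of "inv_into A hom", OF inv])
qed

lemma (in inj_comm_ring_hom) in_integral_closure_if_hom:
  assumes "hom x \<in> integral_closure (hom ` A)"
  shows "x \<in> integral_closure A"
proof -
  obtain q where "q \<in> polys_over (hom ` A)" "lead_coeff q = 1" "poly q (hom x) = 0"
    using assms by (auto simp: integral_closure_def)
  moreover from this obtain q' where "q' \<in> polys_over A" "q = map_poly hom q'"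
    using polys_over_image by blast
  ultimately show ?thesis by (auto simp: integral_closure_def)
qed

section \<open>The polynomial ring over a field is integrally closed\<close>

text \<open>
  The first half of the rational root theorem: clear denominators in the monic equation for
  \<open>x = a / b\<close>. Every term but the leading one, \<open>a ^ degree q\<close>, then contains a factor \<open>b\<close>.
\<close>

lemma denominator_dvd_numerator_power:
  fixes a b :: "'a :: idom"
  assumes x: "to_fract b * x = to_fract a"
    and q: "q \<in> polys_over (range to_fract)" "lead_coeff q = 1" "poly q x = 0"
  shows "b dvd a ^ degree q"
proof -
  define n where "n = degree q"
  obtain c where c: "\<And>i. coeff q i = to_fract (c i)"
    using q(1) unfolding polys_over_def by (auto simp: image_iff) metis
  have pow: "to_fract (y ^ i) = to_fract y ^ i" for y :: 'a and i by (induction i) simp_all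
  have "(\<Sum>i<n. coeff q i * x ^ i) + x ^ n = 0"
    using q(2,3) by (simp add: poly_altdef lessThan_Suc_atMost[symmetric] n_def)
  hence "(\<Sum>i<n. to_fract (c i) * x ^ i) + x ^ n = 0" by (simp only: c)
  hence "0 = to_fract b ^ n * ((\<Sum>i<n. to_fract (c i) * x ^ i) + x ^ n)" by simp
  also have "\<dots> = (\<Sum>i<n. to_fract b ^ n * (to_fract (c i) * x ^ i)) + (to_fract b * x) ^ n"
    by (simp add: ring_distribs sum_distrib_left power_mult_distrib)
  also have "(\<Sum>i<n. to_fract b ^ n * (to_fract (c i) * x ^ i)) =
      (\<Sum>i<n. to_fract (b * (c i * a ^ i * b ^ (n - Suc i))))"
  proof (rule sum.cong)
    fix i assume "i \<in> {..<n}"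
    hence n: "n = i + Suc (n - Suc i)" by simp
    show "to_fract b ^ n * (to_fract (c i) * x ^ i) = to_fract (b * (c i * a ^ i * b ^ (n - Suc i)))"
      by (subst n) (simp add: power_add pow power_mult_distrib mult_ac flip: x)
  qed simp
  also have "\<dots> + (to_fract b * x) ^ n =
      to_fract (b * (\<Sum>i<n. c i * a ^ i * b ^ (n - Suc i)) + a ^ n)"
    by (simp add: x pow sum_distrib_left)
  finally have "b * (\<Sum>i<n. c i * a ^ i * b ^ (n - Suc i)) + a ^ n = 0"
    by (metis to_fract_eq_0_iff)
  hence "a ^ n = b * - (\<Sum>i<n. c i * a ^ i * b ^ (n - Suc i))"
    by (simp add: eq_neg_iff_add_eq_0 add.commute)
  thus ?thesis unfolding n_def by (rule dvdI)
qed

text \<open>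
  Fractions of polynomials can be reduced, with a Bezout certificate: a nonzero element of least
  degree in the ideal generated by \<open>a\<close> and \<open>b\<close> divides the whole ideal, by division with
  remainder.
\<close>

lemma poly_bezout_reduced:
  fixes a b :: "'k :: field poly"
  assumes "b \<noteq> 0"
  obtains d a' b' u w where "d \<noteq> 0" "a = d * a'" "b = d * b'" "u * a' + w * b' = 1"
proof -
  let ?J = "\<lambda>d. d \<noteq> 0 \<and> (\<exists>u w. d = u * a + w * b)"
  define d where "d = arg_min degree ?J"
  have "?J b" using assms by (intro conjI exI[of _ 0] exI[of _ 1]) auto
  hence d: "?J d" unfolding d_def by (rule arg_min_natI)
  have min: "degree d \<le> degree e" if "?J e" for e
    unfolding d_def by (rule arg_min_nat_le[of ?J, OF that])
  from d obtain u w where uw: "d = u * a + w * b" by blast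
  have dvd: "d dvd s * a + t * b" for s t
  proof (rule ccontr)
    let ?e = "s * a + t * b"
    assume nd: "\<not> d dvd ?e"
    have "?e mod d = (s - ?e div d * u) * a + (t - ?e div d * w) * b"
    proof -
      have "?e mod d = ?e - ?e div d * d" by (rule minus_div_mult_eq_mod[symmetric])
      also have "\<dots> = ?e - ?e div d * (u * a + w * b)" using uw by simp
      also have "\<dots> = (s - ?e div d * u) * a + (t - ?e div d * w) * b"
        by (simp only: left_diff_distrib distrib_left mult.assoc) simp
      finally show ?thesis .
    qed
    moreover have "?e mod d \<noteq> 0" using nd by (simp add: mod_eq_0_iff_dvd)
    ultimately have "degree d \<le> degree (?e mod d)" by (intro min) blast
    thus False using degree_mod_less[of d ?e] d \<open>?e mod d \<noteq> 0\<close> by auto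
  qed
  have "d dvd a" "d dvd b" using dvd[of 1 0] dvd[of 0 1] by simp_all
  then obtain a' b' where a: "a = d * a'" and b: "b = d * b'" by (elim dvdE)
  have "d * (u * a' + w * b') = u * (d * a') + w * (d * b')" by (simp add: algebra_simps)
  also have "\<dots> = d * 1" by (simp only: a[symmetric] b[symmetric] uw[symmetric] mult_1_right)
  finally have "d * (u * a' + w * b') = d * 1" .
  hence "u * a' + w * b' = 1" using d by (metis mult_cancel_left)
  with d a b that show ?thesis by blast
qed

lemma bezout_dvd_power_imp_unit:
  fixes a b :: "'a :: comm_ring_1"
  assumes "u * a + w * b = 1" "b dvd a ^ n"
  shows "b dvd 1"
  using assms(2)
proof (induction n)
  case (Suc n)
  have "a ^ n = (u * a + w * b) * a ^ n" using assms(1) by simp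
  also have "\<dots> = u * a ^ Suc n + b * (w * a ^ n)" by (simp add: algebra_simps)
  finally show ?case using Suc by (metis dvd_add dvd_mult dvd_triv_left)
qed simp

lemma integral_closure_range_to_fract_poly:
  "integral_closure (range to_fract) \<subseteq> range (to_fract :: 'k :: field poly \<Rightarrow> _)"
proof
  fix x :: "'k poly fract" assume x: "x \<in> integral_closure (range to_fract)"
  obtain a b where ab: "x = to_fract a / to_fract b" "b \<noteq> 0"
    by (cases x rule: Fract_cases) (simp add: Fract_conv_to_fract)
  obtain d a' b' u w where red: "d \<noteq> 0" "a = d * a'" "b = d * b'" "u * a' + w * b' = 1"
    using poly_bezout_reduced[OF ab(2)] .
  have xb: "to_fract b' * x = to_fract a'" using ab red by auto
  then obtain n where "b' dvd a' ^ n"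
    using x denominator_dvd_numerator_power by (fastforce simp: integral_closure_def)
  with red(4) have "b' dvd 1" by (rule bezout_dvd_power_imp_unit)
  then obtain e where "1 = b' * e" by blast
  hence "x = to_fract (b' * e) * x" by simp
  also have "\<dots> = to_fract e * (to_fract b' * x)" by (simp add: mult_ac)
  also have "\<dots> = to_fract (e * a')" by (simp add: xb)
  finally show "x \<in> range to_fract" by blast
qed

section \<open>The ring \<open>D(p)\<close> and the values at the roots of \<open>p\<close>\<close>

text \<open>
  The exponent counts the linear factors of \<open>P\<close>: each of them divides \<open>g\<close>, and one copy of \<open>g\<close>
  is spent on each, whatever the multiplicities.
\<close>

lemma splitting_poly_dvd_power:
  fixes P g :: "'a :: alg_closed_field poly"
  assumes "P \<noteq> 0" and root: "\<And>\<alpha>. poly P \<alpha> = 0 \<Longrightarrow> poly g \<alpha> = 0"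
  shows "P dvd g ^ degree P"
proof -
  obtain A where A: "size A = degree P" "P = Polynomial.smult (lead_coeff P) (\<Prod>\<alpha>\<in>#A. [:-\<alpha>, 1:])"
    using alg_closed_imp_factorization[OF assms(1)] by blast
  have "poly P \<alpha> = 0" if "\<alpha> \<in># A" for \<alpha>
    by (subst A(2)) (use that in \<open>auto simp: poly_prod_mset prod_mset_zero_iff\<close>)
  hence "\<forall>\<alpha>\<in>#A. [:-\<alpha>, 1:] dvd g" using root by (simp add: poly_eq_0_iff_dvd)
  hence "(\<Prod>\<alpha>\<in>#A. [:-\<alpha>, 1:]) dvd g ^ size A"
  proof (induction A)
    case (add \<alpha> A)
    hence "[:-\<alpha>, 1:] * (\<Prod>\<alpha>\<in>#A. [:-\<alpha>, 1:]) dvd g * g ^ size A"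
      by (intro mult_dvd_mono) simp_all
    thus ?case by simp
  qed simp
  thus ?thesis using assms(1) by (subst A(2)) (simp add: A(1) smult_dvd_iff)
qed

lemma is_subring_D_p_ring:
  assumes "is_subring D"
  shows "is_subring (D_p_ring D p)"
proof -
  note P = is_subring_polys_over[OF assms]
  show ?thesis unfolding is_subring_def D_p_ring_def
  proof (intro conjI ballI)
    show "1 \<in> {r + p * q | r q. r \<in> polys_over D}"
      by (intro CollectI exI[of _ 1] exI[of _ 0]) (simp add: is_subring_closed[OF P])
    fix x y
    assume "x \<in> {r + p * q | r q. r \<in> polys_over D}" "y \<in> {r + p * q | r q. r \<in> polys_over D}"
    then obtain r q r' q' where xy: "x = r + p * q" "y = r' + p * q'"
      "r \<in> polys_over D" "r' \<in> polys_over D" by blast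
    show "x - y \<in> {r + p * q | r q. r \<in> polys_over D}"
      by (intro CollectI exI[of _ "r - r'"] exI[of _ "q - q'"])
        (simp add: xy is_subring_closed[OF P] algebra_simps)
    show "x * y \<in> {r + p * q | r q. r \<in> polys_over D}"
      by (intro CollectI exI[of _ "r * r'"] exI[of _ "r * q' + q * r' + p * q * q'"])
        (simp add: xy is_subring_closed[OF P] algebra_simps)
  qed
qed

text \<open>
  Expanding a fraction by \<open>p\<close> moves numerator and denominator into the multiples of \<open>p\<close>, all of
  which belong to \<open>D(p)\<close>.
\<close>

lemma domain_with_quotient_field_D_p_ring:
  fixes D :: "'k :: field set"
  assumes D: "is_subring D" and "p \<noteq> 0"
  shows "domain_with_quotient_field_UNIV (to_fract ` D_p_ring D p)"
proof -
  have "0 \<in> polys_over D" using is_subring_closed(2)[OF is_subring_polys_over[OF D]] .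
  hence mult: "p * h \<in> D_p_ring D p" for h
    unfolding D_p_ring_def by (intro CollectI exI[of _ 0] exI[of _ h]) auto
  have "is_subring (to_fract ` D_p_ring D p)"
    using is_subring_D_p_ring[OF D, of p] unfolding is_subring_def
    by (auto simp flip: to_fract_1 to_fract_diff to_fract_mult)
  moreover have "\<exists>a\<in>to_fract ` D_p_ring D p. \<exists>b\<in>to_fract ` D_p_ring D p. b \<noteq> 0 \<and> x = a / b" for x
  proof -
    obtain a b where "x = to_fract a / to_fract b" "b \<noteq> 0"
      by (cases x rule: Fract_cases) (simp add: Fract_conv_to_fract)
    thus ?thesis using mult \<open>p \<noteq> 0\<close>
      by (intro bexI[of _ "to_fract (p * a)"] bexI[of _ "to_fract (p * b)"] imageI) simp_all
  qed
  ultimately show ?thesis by (simp add: domain_with_quotient_field_UNIV_def)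
qed

text \<open>
  The value \<open>H(f)\<close> is a multiple of \<open>p\<close>, hence lies in \<open>D(p)\<close>, so \<open>f\<close> is a root of
  \<open>H(T) - H(f)\<close>, viewed as a polynomial in \<open>T\<close> over \<open>D(p)\<close>. As \<open>H\<close> has
  positive degree, only its constant term changes and the polynomial remains monic.
\<close>

lemma integral_over_D_p_ring_if_dvd_pcompose:
  fixes D :: "'k :: field set"
  assumes D: "is_subring D"
    and H: "H \<in> polys_over D" "lead_coeff H = 1" "degree H > 0"
    and dvd: "p dvd H \<circ>\<^sub>p f"
  shows "f \<in> integral_closure (D_p_ring D p)"
proof -
  obtain h where h: "H \<circ>\<^sub>p f = p * h" using dvd by blast
  define Q where "Q = map_poly (\<lambda>c. [:c:]) H - [:H \<circ>\<^sub>p f:]"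
  note S = is_subring_D_p_ring[OF D, of p]
  have cH: "coeff (map_poly (\<lambda>c. [:c:]) H) i = [:coeff H i:]" for i
    by (simp add: coeff_map_poly)
  have 0: "0 \<in> polys_over D" using is_subring_closed(2)[OF is_subring_polys_over[OF D]] .
  have "[:coeff H i:] \<in> D_p_ring D p" for i
    unfolding D_p_ring_def using H(1)
    by (intro CollectI exI[of _ "[:coeff H i:]"] exI[of _ 0])
      (simp add: polys_over_pCons_iff 0, simp add: polys_over_def)
  moreover have "H \<circ>\<^sub>p f \<in> D_p_ring D p"
    unfolding D_p_ring_def using 0 by (intro CollectI exI[of _ 0] exI[of _ h]) (simp add: h)
  ultimately have "Q \<in> polys_over (D_p_ring D p)"
    by (auto simp: polys_over_def Q_def cH coeff_pCons is_subring_closed[OF S] split: nat.splits)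
  moreover have "lead_coeff Q = 1"
  proof -
    have "degree (map_poly (\<lambda>c. [:c:]) H) = degree H" by (intro degree_map_poly) auto
    hence "degree [:H \<circ>\<^sub>p f:] < degree (map_poly (\<lambda>c. [:c:]) H)" using H(3) by simp
    hence "lead_coeff Q = lead_coeff (map_poly (\<lambda>c. [:c:]) H)"
      unfolding Q_def by (metis diff_conv_add_uminus degree_minus lead_coeff_add_le add.commute)
    also have "\<dots> = [:lead_coeff H:]" by (simp add: cH \<open>degree _ = degree H\<close>)
    finally show ?thesis using H(2) by (simp add: one_pCons)
  qed
  moreover have "poly Q f = 0" by (simp add: Q_def pcompose_altdef)
  ultimately show ?thesis by (auto simp: integral_closure_def)
qed

theorem theorem1p3:
  fixes D :: "'k :: field set"
    and \<iota> :: "'k \<Rightarrow> 'l :: alg_closed_field"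
    and p :: "'k poly"
  assumes "domain_with_quotient_field_UNIV D"
    and "\<not> is_subfield D"
    and "is_algebraic_closure \<iota>"
    and "p \<in> polys_over D" and "lead_coeff p = 1" and "degree p > 0"
  shows "domain_with_quotient_field_UNIV (to_fract ` D_p_ring D p :: 'k poly fract set)
    \<and> integral_closure (to_fract ` D_p_ring D p :: 'k poly fract set)
      = to_fract ` Int_K \<iota> (set_mset (roots_in \<iota> p)) (integral_closure (\<iota> ` D))"
proof -
  have D: "is_subring D" using assms(1) by (simp add: domain_with_quotient_field_UNIV_def)
  have add: "\<iota> (x + y) = \<iota> x + \<iota> y" and mult: "\<iota> (x * y) = \<iota> x * \<iota> y" and one: "\<iota> 1 = 1" for x y
    using assms(3) by (auto simp: is_algebraic_closure_def is_field_embedding_def)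
  have zero: "\<iota> 0 = 0" using add[of 0 0] by (simp only: add_0_right add_cancel_right_right)
  interpret \<iota>: field_hom \<iota> by unfold_locales (fact zero one add mult)+
  interpret \<iota>p: map_poly_inj_idom_hom \<iota> ..
  interpret fr: inj_idom_hom "to_fract :: 'k poly \<Rightarrow> _" by unfold_locales auto
  have \<iota>D: "is_subring (\<iota> ` D)"
    using D unfolding is_subring_def by (auto simp flip: one mult \<iota>.hom_minus)
  have p0: "p \<noteq> 0" using assms(6) by auto
  have roots: "set_mset (roots_in \<iota> p) = {\<alpha>. poly (map_poly \<iota> p) \<alpha> = 0}"
    unfolding roots_in_def using p0 by (intro set_count_proots) simp
  have over: "map_poly \<iota> r \<in> polys_over (\<iota> ` D)" if "r \<in> polys_over D" for r
    using that by (auto simp: polys_over_def)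

  \<comment> \<open>Evaluation at a root sends \<open>D(p)\<close> into \<open>D[\<alpha>]\<close>, which is integral over \<open>D\<close>.\<close>
  have sub: "f \<in> Int_K \<iota> (set_mset (roots_in \<iota> p)) (integral_closure (\<iota> ` D))"
    if f: "f \<in> integral_closure (D_p_ring D p)" for f
    unfolding Int_K_def
  proof (intro CollectI ballI)
    fix \<alpha> assume "\<alpha> \<in># roots_in \<iota> p"
    hence \<alpha>: "poly (map_poly \<iota> p) \<alpha> = 0" using roots by blast
    let ?ev = "\<lambda>g. poly (map_poly \<iota> g) \<alpha>"
    interpret ev: comm_ring_hom ?ev by unfold_locales (simp_all add: hom_distribs)
    have "?ev ` D_p_ring D p \<subseteq> (\<lambda>r. poly r \<alpha>) ` polys_over (\<iota> ` D)"
      using \<alpha> over by (auto simp: D_p_ring_def hom_distribs)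
    hence "?ev f \<in> integral_closure ((\<lambda>r. poly r \<alpha>) ` polys_over (\<iota> ` D))"
      using ev.hom_integral_closure[OF f] integral_closure_mono by blast
    moreover have "\<alpha> \<in> integral_closure (\<iota> ` D)"
      using over[OF assms(4)] \<alpha> assms(5) unfolding integral_closure_def
      by (intro CollectI bexI[of _ "map_poly \<iota> p"]) (simp_all add: one)
    ultimately show "?ev f \<in> integral_closure (\<iota> ` D)"
      using integral_closure_tower[OF \<iota>D] by blast
  qed

  \<comment> \<open>Integrality of the finitely many values at the roots is assembled into one equation.\<close>
  have sup: "f \<in> integral_closure (D_p_ring D p)"
    if f: "f \<in> Int_K \<iota> (set_mset (roots_in \<iota> p)) (integral_closure (\<iota> ` D))" for f
  proof -
    let ?R = "{\<alpha>. poly (map_poly \<iota> p) \<alpha> = 0}"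
    have "\<forall>\<alpha>\<in>?R. \<exists>q. q \<in> polys_over D \<and> lead_coeff q = 1 \<and>
        poly (map_poly \<iota> q) (poly (map_poly \<iota> f) \<alpha>) = 0"
    proof
      fix \<alpha> assume "\<alpha> \<in> ?R"
      hence "poly (map_poly \<iota> f) \<alpha> \<in> integral_closure (\<iota> ` D)"
        using f unfolding Int_K_def roots by blast
      then obtain q where "q \<in> polys_over (\<iota> ` D)" "lead_coeff q = 1" "poly q (poly (map_poly \<iota> f) \<alpha>) = 0"
        unfolding integral_closure_def by blast
      moreover from this obtain q' where "q' \<in> polys_over D" "q = map_poly \<iota> q'"
        using \<iota>.polys_over_image by blast
      ultimately show "\<exists>q. q \<in> polys_over D \<and> lead_coeff q = 1 \<and>
          poly (map_poly \<iota> q) (poly (map_poly \<iota> f) \<alpha>) = 0"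
        by auto
    qed
    from bchoice[OF this] obtain q where q: "\<And>\<alpha>. \<alpha> \<in> ?R \<Longrightarrow> q \<alpha> \<in> polys_over D"
      "\<And>\<alpha>. \<alpha> \<in> ?R \<Longrightarrow> lead_coeff (q \<alpha>) = 1"
      "\<And>\<alpha>. \<alpha> \<in> ?R \<Longrightarrow> poly (map_poly \<iota> (q \<alpha>)) (poly (map_poly \<iota> f) \<alpha>) = 0"
      by blast
    define G where "G = (\<Prod>\<alpha>\<in>?R. q \<alpha>)"
    \<comment> \<open>The factor \<open>[:0, 1:]\<close> only serves to make the degree of \<open>H\<close> visibly positive.\<close>
    define H where "H = [:0, 1:] * G ^ degree p"
    note P = is_subring_polys_over[OF D]
    have R: "finite ?R" using p0 by (intro poly_roots_finite) simp
    have G1: "lead_coeff G = 1" unfolding G_def lead_coeff_prod using q(2) by (rule prod.neutral[OF ballI])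
    have "poly (map_poly \<iota> (G \<circ>\<^sub>p f)) \<alpha> = 0" if "\<alpha> \<in> ?R" for \<alpha>
    proof -
      have "poly (map_poly \<iota> (G \<circ>\<^sub>p f)) \<alpha> =
          (\<Prod>\<beta>\<in>?R. poly (map_poly \<iota> (q \<beta>)) (poly (map_poly \<iota> f) \<alpha>))"
        by (simp only: G_def \<iota>.map_poly_pcompose poly_pcompose \<iota>p.hom_prod poly_prod)
      also have "\<dots> = 0" using that q(3)[OF that] by (intro prod_zero[OF R] bexI)
      finally show ?thesis .
    qed
    hence "map_poly \<iota> p dvd map_poly \<iota> (G \<circ>\<^sub>p f) ^ degree (map_poly \<iota> p)"
      using p0 by (intro splitting_poly_dvd_power) auto
    hence "map_poly \<iota> p dvd map_poly \<iota> ((G \<circ>\<^sub>p f) ^ degree p)" 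
      by (simp only: \<iota>p.hom_power \<iota>.degree_map_poly_hom)
    hence "p dvd (G \<circ>\<^sub>p f) ^ degree p" by (rule \<iota>.dvd_map_poly_hom_imp_dvd)
    hence "p dvd H \<circ>\<^sub>p f"
      by (simp only: H_def pcompose_hom.hom_mult pcompose_hom.hom_power dvd_mult)
    moreover have "H \<in> polys_over D"
      unfolding H_def G_def using q(1)
      by (intro is_subring_closed(6)[OF P] is_subring_power[OF P] is_subring_prod[OF P])
        (auto simp: polys_over_pCons_iff is_subring_closed[OF D] is_subring_closed(2)[OF P])
    moreover have "lead_coeff H = 1"
      unfolding H_def by (simp only: lead_coeff_mult lead_coeff_power G1) simp
    moreover have "degree H > 0"
    proof -
      have "G \<noteq> 0" using G1 by auto
      thus ?thesis unfolding H_def by (subst degree_mult_eq) auto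
    qed
    ultimately show ?thesis by (intro integral_over_D_p_ring_if_dvd_pcompose[OF D])
  qed

  have "integral_closure (to_fract ` D_p_ring D p) \<subseteq> range (to_fract :: 'k poly \<Rightarrow> _)"
    using integral_closure_range_to_fract_poly integral_closure_mono[of "to_fract ` D_p_ring D p" "range to_fract"]
    by blast
  hence "integral_closure (to_fract ` D_p_ring D p) = to_fract ` integral_closure (D_p_ring D p)"
    using fr.hom_integral_closure fr.in_integral_closure_if_hom by blast
  also have "integral_closure (D_p_ring D p) =
      Int_K \<iota> (set_mset (roots_in \<iota> p)) (integral_closure (\<iota> ` D))"
    using sub sup by blast
  finally show ?thesis using domain_with_quotient_field_D_p_ring[OF D p0] by simp
qed

end
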